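(* Let $E$ be a set of equations in the language of residuated ortholattices, let $\mathsf V=\mathsf{OML}+E$, let $\mathsf W=\mathsf{ROL}+\mathrm T[E]$, and suppose $\mathsf U$ is a variety of residuated ortholattices with $\mathsf V\subseteq\mathsf U\subseteq\mathsf W$. Then $\mathsf V$ is translatable into $\mathsf U$, i.e., for every set of equations $D\cup\{s\approx t\}$ in the language of residuated ortholattices, $D\models_{\mathsf V}s\approx t$ if and only if $\mathrm T[D]\models_{\mathsf U}\mathrm T(s)\approx\mathrm T(t)$.
   Context: A residuated ortholattice (ROL) is an algebra $(A,\wedge,\vee,\neg,\backslash,0,1)$ where $(A,\wedge,\vee,0,1)$ is a bounded lattice, $\neg$ is an order-reversing involution, and $x\cdot y\le z\iff y\le x\backslash z$ for all $x,y,z$, where $x\cdot y:=x\wedge(\neg x\vee y)$; $\mathsf{ROL}$ is the variety of ROLs. Orthomodular lattices (ortholattices satisfying $x\le y\implies y\approx x\vee(y\wedge\neg x)$) are regarded as ROLs with $x\backslash y:=\neg x\vee(x\wedge y)$; $\mathsf{OML}$ denotes this subvariety. $\mathsf K+E$ is the subvariety of $\mathsf K$ axiomatized by $E$. $\models_{\mathsf K}$ is relative equational consequence: $D\models_{\mathsf K}s\approx t$ iff for every $\mathbf A\in\mathsf K$ and every assignment in $\mathbf A$ satisfying all equations of $D$, also $s\approx t$ holds. Let ${\sim}x:=x\backslash 0$. The translation $\mathrm T$ on ROL terms: $\mathrm T(0)=0$, $\mathrm T(1)=1$, $\mathrm T(x)={\sim}{\sim}x$ for variables, $\mathrm T(\neg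 s)={\sim}\mathrm T(s)$, $\mathrm T(r\star s)=\mathrm T(r)\star\mathrm T(s)$ for $\star\in\{\wedge,\vee,\backslash\}$; $\mathrm T[E]:=\{\mathrm T(u)\approx\mathrm T(v):(u\approx v)\in E\}$. *)

theory Defs
  imports "HOL-Algebra.Congruence"
begin

text \<open>Algebras in the signature \<open>(\<and>, \<or>, \<not>, \<setminus>, 0, 1)\<close>. Membership in the classes below depends
  only on the behaviour of the operations on the carrier.\<close>

record 'a rol_alg = "'a partial_object" +
  meet :: "'a \<Rightarrow> 'a \<Rightarrow> 'a" (infixl \<open>\<sqinter>\<index>\<close> 70)
  join :: "'a \<Rightarrow> 'a \<Rightarrow> 'a" (infixl \<open>\<squnion>\<index>\<close> 65)
  neg :: "'a \<Rightarrow> 'a"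
  resid :: "'a \<Rightarrow> 'a \<Rightarrow> 'a" (infixr \<open>\<setminus>\<index>\<close> 60)
  bot_el :: 'a (\<open>\<bottom>\<index>\<close>)
  top_el :: 'a (\<open>\<top>\<index>\<close>)

definition leq :: "('a, 'm) rol_alg_scheme \<Rightarrow> 'a \<Rightarrow> 'a \<Rightarrow> bool" (infix \<open>\<sqsubseteq>\<index>\<close> 50)
  where "x \<sqsubseteq>\<^bsub>A\<^esub> y \<longleftrightarrow> x \<sqinter>\<^bsub>A\<^esub> y = x"

definition mult :: "('a, 'm) rol_alg_scheme \<Rightarrow> 'a \<Rightarrow> 'a \<Rightarrow> 'a" (infixl \<open>\<cdot>\<index>\<close> 70)
  where "x \<cdot>\<^bsub>A\<^esub> y = x \<sqinter>\<^bsub>A\<^esub> (neg A x \<squnion>\<^bsub>A\<^esub> y)"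

locale involutive_bounded_lattice =
  fixes A (structure)
  assumes meet_closed: "\<lbrakk>x \<in> carrier A; y \<in> carrier A\<rbrakk> \<Longrightarrow> x \<sqinter> y \<in> carrier A"
    and join_closed: "\<lbrakk>x \<in> carrier A; y \<in> carrier A\<rbrakk> \<Longrightarrow> x \<squnion> y \<in> carrier A"
    and neg_closed: "x \<in> carrier A \<Longrightarrow> neg A x \<in> carrier A"
    and resid_closed: "\<lbrakk>x \<in> carrier A; y \<in> carrier A\<rbrakk> \<Longrightarrow> x \<setminus> y \<in> carrier A"
    and bot_closed: "\<bottom> \<in> carrier A"
    and top_closed: "\<top> \<in> carrier A"
    and meet_comm: "\<lbrakk>x \<in> carrier A; y \<in> carrier A\<rbrakk> \<Longrightarrow> x \<sqinter> y = y \<sqinter> x"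
    and join_comm: "\<lbrakk>x \<in> carrier A; y \<in> carrier A\<rbrakk> \<Longrightarrow> x \<squnion> y = y \<squnion> x"
    and meet_assoc: "\<lbrakk>x \<in> carrier A; y \<in> carrier A; z \<in> carrier A\<rbrakk> \<Longrightarrow> x \<sqinter> y \<sqinter> z = x \<sqinter> (y \<sqinter> z)"
    and join_assoc: "\<lbrakk>x \<in> carrier A; y \<in> carrier A; z \<in> carrier A\<rbrakk> \<Longrightarrow> x \<squnion> y \<squnion> z = x \<squnion> (y \<squnion> z)"
    and meet_absorb: "\<lbrakk>x \<in> carrier A; y \<in> carrier A\<rbrakk> \<Longrightarrow> x \<sqinter> (x \<squnion> y) = x"
    and join_absorb: "\<lbrakk>x \<in> carrier A; y \<in> carrier A\<rbrakk> \<Longrightarrow> x \<squnion> (x \<sqinter> y) = x"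
    and bot_least: "x \<in> carrier A \<Longrightarrow> \<bottom> \<sqsubseteq> x"
    and top_greatest: "x \<in> carrier A \<Longrightarrow> x \<sqsubseteq> \<top>"
    and neg_neg: "x \<in> carrier A \<Longrightarrow> neg A (neg A x) = x"
    and neg_antimono: "\<lbrakk>x \<in> carrier A; y \<in> carrier A; x \<sqsubseteq> y\<rbrakk> \<Longrightarrow> neg A y \<sqsubseteq> neg A x"

locale residuated_ortholattice = involutive_bounded_lattice +
  assumes residuation: "\<lbrakk>x \<in> carrier A; y \<in> carrier A; z \<in> carrier A\<rbrakk>
    \<Longrightarrow> x \<cdot> y \<sqsubseteq> z \<longleftrightarrow> y \<sqsubseteq> x \<setminus> z"

locale orthomodular_lattice = involutive_bounded_lattice +
  assumes meet_neg: "x \<in> carrier A \<Longrightarrow> x \<sqinter> neg A x = \<bottom>"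
    and join_neg: "x \<in> carrier A \<Longrightarrow> x \<squnion> neg A x = \<top>"
    and orthomodular: "\<lbrakk>x \<in> carrier A; y \<in> carrier A; x \<sqsubseteq> y\<rbrakk> \<Longrightarrow> y = x \<squnion> (y \<sqinter> neg A x)"
    and resid_Sasaki: "\<lbrakk>x \<in> carrier A; y \<in> carrier A\<rbrakk> \<Longrightarrow> x \<setminus> y = neg A x \<squnion> (x \<sqinter> y)"

text \<open>Classes of algebras are relative to a type \<open>'a\<close> from which the elements of the carriers are
  drawn. Since terms have countably many variables, varieties and their relative equational
  consequence relations are determined by countable algebras; hence nothing is lost as soon as
  \<open>'a\<close> is infinite.\<close>

definition ROL :: "'a rol_alg set"
  where "ROL = {A. residuated_ortholattice A}"

definition OML :: "'a rol_alg set"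
  where "OML = {A. orthomodular_lattice A}"

datatype rol_term =
    Var nat
  | Zero
  | One
  | Neg rol_term
  | Meet rol_term rol_term
  | Join rol_term rol_term
  | Res rol_term rol_term

text \<open>The pair \<open>(s, t)\<close> stands for the equation \<open>s \<approx> t\<close>.\<close>

type_synonym equation = "rol_term \<times> rol_term"

primrec eval :: "('a, 'm) rol_alg_scheme \<Rightarrow> (nat \<Rightarrow> 'a) \<Rightarrow> rol_term \<Rightarrow> 'a" where
  "eval A h (Var i) = h i"
| "eval A h Zero = \<bottom>\<^bsub>A\<^esub>"
| "eval A h One = \<top>\<^bsub>A\<^esub>"
| "eval A h (Neg s) = neg A (eval A h s)"
| "eval A h (Meet r s) = eval A h r \<sqinter>\<^bsub>A\<^esub> eval A h s"
| "eval A h (Join r s) = eval A h r \<squnion>\<^bsub>A\<^esub> eval A h s"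
| "eval A h (Res r s) = eval A h r \<setminus>\<^bsub>A\<^esub> eval A h s"

definition satisfies :: "('a, 'm) rol_alg_scheme \<Rightarrow> (nat \<Rightarrow> 'a) \<Rightarrow> equation \<Rightarrow> bool"
  where "satisfies A h e \<longleftrightarrow> eval A h (fst e) = eval A h (snd e)"

definition valid :: "('a, 'm) rol_alg_scheme \<Rightarrow> equation \<Rightarrow> bool"
  where "valid A e \<longleftrightarrow> (\<forall>h \<in> UNIV \<rightarrow> carrier A. satisfies A h e)"

definition axiomatized_by :: "'a rol_alg set \<Rightarrow> equation set \<Rightarrow> 'a rol_alg set" (infixl \<open>\<oplus>\<close> 65)
  where "K \<oplus> E = {A \<in> K. \<forall>e \<in> E. valid A e}"

definition rol_variety :: "'a rol_alg set \<Rightarrow> bool"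
  where "rol_variety U \<longleftrightarrow> (\<exists>E. U = ROL \<oplus> E)"

definition consequence :: "equation set \<Rightarrow> 'a rol_alg set \<Rightarrow> equation \<Rightarrow> bool"
    (\<open>_ \<Turnstile>\<^bsub>_\<^esub> _\<close> [51, 0, 51] 50)
  where "D \<Turnstile>\<^bsub>K\<^esub> e \<longleftrightarrow>
    (\<forall>A \<in> K. \<forall>h \<in> UNIV \<rightarrow> carrier A. (\<forall>d \<in> D. satisfies A h d) \<longrightarrow> satisfies A h e)"

abbreviation Pneg :: "rol_term \<Rightarrow> rol_term"
  where "Pneg s \<equiv> Res s Zero"

primrec T :: "rol_term \<Rightarrow> rol_term" where
  "T (Var i) = Pneg (Pneg (Var i))"
| "T Zero = Zero"
| "T One = One"
| "T (Neg s) = Pneg (T s)"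
| "T (Meet r s) = Meet (T r) (T s)"
| "T (Join r s) = Join (T r) (T s)"
| "T (Res r s) = Res (T r) (T s)"

definition T_eqs :: "equation set \<Rightarrow> equation set" (\<open>T[_]\<close>)
  where "T[E] = {(T u, T v) | u v. (u, v) \<in> E}"

definition translatable :: "'a rol_alg set \<Rightarrow> 'a rol_alg set \<Rightarrow> bool"
  where "translatable V U \<longleftrightarrow> (\<forall>D s t. D \<Turnstile>\<^bsub>V\<^esub> (s, t) \<longleftrightarrow> T[D] \<Turnstile>\<^bsub>U\<^esub> (T s, T t))"

end

theory Submission
  imports Defs
begin

text \<open>Let \<open>A\<close> be a residuated ortholattice. The relation \<open>x \<cdot> y = 0\<close> turns out to be symmetric,
  so \<open>\<sim>\<close> is a Galois connection of \<open>A\<close> with itself and \<open>\<sim>\<sim>\<close> is a closure operator. Moreover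
  \<open>t \<cdot> x = x\<close> for closed \<open>x \<le> t\<close>. Since \<open>t \<cdot> _\<close> preserves joins and \<open>x \<or> \<sim>x = 1\<close>, it follows that
  the closed elements are closed under \<open>\<and>\<close>, \<open>\<or>\<close> and \<open>\<setminus>\<close>, and that with \<open>\<sim>\<close> as negation they form
  an orthomodular lattice in which \<open>\<setminus>\<close> is the Sasaki hook. A term evaluates in this lattice to
  what its translation evaluates to in \<open>A\<close>; conversely, \<open>\<sim>\<close> and \<open>\<not>\<close> agree in an orthomodular
  lattice, so there \<open>T\<close> does not change the value of a term.\<close>

section \<open>Lattice order, De Morgan laws and the Sasaki product\<close>

context involutive_bounded_lattice
begin

lemmas closed [simp, intro] =
  meet_closed join_closed neg_closed resid_closed bot_closed top_closed

lemma mult_closed [simp, intro]: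
  "\<lbrakk>x \<in> carrier A; y \<in> carrier A\<rbrakk> \<Longrightarrow> x \<cdot> y \<in> carrier A"
  by (simp add: mult_def)

lemma meet_idem [simp]: "x \<in> carrier A \<Longrightarrow> x \<sqinter> x = x"
  by (metis closed(1) join_absorb meet_absorb)

lemma leq_refl [simp]: "x \<in> carrier A \<Longrightarrow> x \<sqsubseteq> x"
  by (simp add: leq_def)

lemma leq_antisym: "\<lbrakk>x \<sqsubseteq> y; y \<sqsubseteq> x; x \<in> carrier A; y \<in> carrier A\<rbrakk> \<Longrightarrow> x = y"
  by (metis leq_def meet_comm)

lemma leq_trans: "\<lbrakk>x \<sqsubseteq> y; y \<sqsubseteq> z; x \<in> carrier A; y \<in> carrier A; z \<in> carrier A\<rbrakk> \<Longrightarrow> x \<sqsubseteq> z"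
  by (metis leq_def meet_assoc)

lemma leq_iff_join: "\<lbrakk>x \<in> carrier A; y \<in> carrier A\<rbrakk> \<Longrightarrow> x \<sqsubseteq> y \<longleftrightarrow> x \<squnion> y = y"
  by (metis leq_def meet_absorb join_absorb meet_comm join_comm)

lemma meet_leq1 [simp]: "\<lbrakk>x \<in> carrier A; y \<in> carrier A\<rbrakk> \<Longrightarrow> x \<sqinter> y \<sqsubseteq> x"
  by (metis closed(1) leq_def meet_assoc meet_comm meet_idem)

lemma meet_leq2 [simp]: "\<lbrakk>x \<in> carrier A; y \<in> carrier A\<rbrakk> \<Longrightarrow> x \<sqinter> y \<sqsubseteq> y"
  by (metis meet_comm meet_leq1)

lemma leq_meet_iff [simp]:
  assumes "x \<in> carrier A" "y \<in> carrier A" "z \<in> carrier A"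
  shows "z \<sqsubseteq> x \<sqinter> y \<longleftrightarrow> z \<sqsubseteq> x \<and> z \<sqsubseteq> y"
proof
  show "z \<sqsubseteq> x \<and> z \<sqsubseteq> y" if "z \<sqsubseteq> x \<sqinter> y"
    using that assms by (meson closed(1) leq_trans meet_leq1 meet_leq2)
  show "z \<sqsubseteq> x \<sqinter> y" if "z \<sqsubseteq> x \<and> z \<sqsubseteq> y"
    using that assms by (metis leq_def meet_assoc)
qed

lemma join_geq1 [simp]: "\<lbrakk>x \<in> carrier A; y \<in> carrier A\<rbrakk> \<Longrightarrow> x \<sqsubseteq> x \<squnion> y"
  by (simp add: leq_def meet_absorb)

lemma join_geq2 [simp]: "\<lbrakk>x \<in> carrier A; y \<in> carrier A\<rbrakk> \<Longrightarrow> y \<sqsubseteq> x \<squnion> y"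
  by (metis join_comm join_geq1)

lemma join_leq_iff [simp]:
  assumes "x \<in> carrier A" "y \<in> carrier A" "z \<in> carrier A"
  shows "x \<squnion> y \<sqsubseteq> z \<longleftrightarrow> x \<sqsubseteq> z \<and> y \<sqsubseteq> z"
proof
  show "x \<sqsubseteq> z \<and> y \<sqsubseteq> z" if "x \<squnion> y \<sqsubseteq> z"
    using that assms by (meson closed(2) leq_trans join_geq1 join_geq2)
  show "x \<squnion> y \<sqsubseteq> z" if "x \<sqsubseteq> z \<and> y \<sqsubseteq> z"
    using that assms by (metis closed(2) leq_iff_join join_assoc)
qed

lemma leq_bot_iff: "x \<in> carrier A \<Longrightarrow> x \<sqsubseteq> \<bottom> \<longleftrightarrow> x = \<bottom>"
  by (metis bot_closed bot_least leq_antisym leq_refl)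

lemma top_leq_iff: "x \<in> carrier A \<Longrightarrow> \<top> \<sqsubseteq> x \<longleftrightarrow> x = \<top>"
  by (metis top_closed top_greatest leq_antisym leq_refl)

lemma bounds_simps [simp]:
  assumes "x \<in> carrier A"
  shows "\<bottom> \<sqinter> x = \<bottom>" "x \<sqinter> \<bottom> = \<bottom>" "\<bottom> \<squnion> x = x" "x \<squnion> \<bottom> = x"
    "\<top> \<sqinter> x = x" "x \<sqinter> \<top> = x" "\<top> \<squnion> x = \<top>" "x \<squnion> \<top> = \<top>"
proof -
  show "\<bottom> \<sqinter> x = \<bottom>" "x \<sqinter> \<top> = x"
    using assms bot_least top_greatest by (simp_all add: leq_def)
  then show "x \<sqinter> \<bottom> = \<bottom>" "\<top> \<sqinter> x = x"
    using assms by (simp_all add: meet_comm)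
  show "\<bottom> \<squnion> x = x" "x \<squnion> \<top> = \<top>"
    using assms bot_least top_greatest by (simp_all flip: leq_iff_join)
  then show "x \<squnion> \<bottom> = x" "\<top> \<squnion> x = \<top>"
    using assms by (simp_all add: join_comm)
qed

lemma neg_leq_iff: "\<lbrakk>x \<in> carrier A; y \<in> carrier A\<rbrakk> \<Longrightarrow> neg A x \<sqsubseteq> neg A y \<longleftrightarrow> y \<sqsubseteq> x"
  by (metis neg_antimono neg_closed neg_neg)

lemma neg_leq_swap: "\<lbrakk>x \<in> carrier A; y \<in> carrier A\<rbrakk> \<Longrightarrow> neg A x \<sqsubseteq> y \<longleftrightarrow> neg A y \<sqsubseteq> x"
  by (metis neg_antimono neg_closed neg_neg)

lemma neg_join:
  assumes "x \<in> carrier A" "y \<in> carrier A"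
  shows "neg A (x \<squnion> y) = neg A x \<sqinter> neg A y"
proof (rule leq_antisym)
  show "neg A (x \<squnion> y) \<sqsubseteq> neg A x \<sqinter> neg A y"
    using assms by (simp add: neg_leq_iff)
  show "neg A x \<sqinter> neg A y \<sqsubseteq> neg A (x \<squnion> y)"
    using assms by (metis closed(1,2,3) join_leq_iff meet_leq1 meet_leq2 neg_leq_iff neg_neg)
qed (use assms in auto)

lemma neg_meet:
  assumes "x \<in> carrier A" "y \<in> carrier A"
  shows "neg A (x \<sqinter> y) = neg A x \<squnion> neg A y"
  using assms by (metis closed(2,3) neg_join neg_neg)

lemma neg_bot [simp]: "neg A \<bottom> = \<top>"
  by (metis bot_closed bot_least neg_closed neg_antimono neg_neg top_closed top_leq_iff)

lemma mult_leq [simp]: "\<lbrakk>x \<in> carrier A; y \<in> carrier A\<rbrakk> \<Longrightarrow> x \<cdot> y \<sqsubseteq> x"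
  by (simp add: mult_def)

text \<open>The second factor \<open>neg A x \<squnion> y\<close> collapses to \<open>y\<close>.
  This is the bridge between products, which preserve joins, and plain meets.\<close>

lemma mult_absorb_neg:
  "\<lbrakk>x \<in> carrier A; y \<in> carrier A; neg A x \<sqsubseteq> y\<rbrakk> \<Longrightarrow> x \<cdot> y = x \<sqinter> y"
  by (simp add: mult_def leq_iff_join)

lemma meet_leq_mult: "\<lbrakk>x \<in> carrier A; y \<in> carrier A\<rbrakk> \<Longrightarrow> x \<sqinter> y \<sqsubseteq> x \<cdot> y"
  by (simp add: mult_def) (meson closed join_geq2 leq_trans meet_leq2)

end

text \<open>In a residuated ortholattice this is the largest \<open>y\<close> with
  \<open>x \<cdot> y = \<bottom>\<close>.\<close>

definition rneg :: "('a, 'm) rol_alg_scheme \<Rightarrow> 'a \<Rightarrow> 'a" (\<open>\<sim>\<index> _\<close> [80] 80)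
  where "\<sim>\<^bsub>A\<^esub> x = x \<setminus>\<^bsub>A\<^esub> \<bottom>\<^bsub>A\<^esub>"

section \<open>Consequences of residuation and symmetry of vanishing products\<close>

context residuated_ortholattice
begin

lemma rneg_closed [simp, intro]: "x \<in> carrier A \<Longrightarrow> \<sim> x \<in> carrier A"
  by (simp add: rneg_def)

lemma leq_rneg_iff:
  "\<lbrakk>x \<in> carrier A; y \<in> carrier A\<rbrakk> \<Longrightarrow> y \<sqsubseteq> \<sim> x \<longleftrightarrow> x \<cdot> y = \<bottom>"
  by (metis bot_closed leq_bot_iff mult_closed residuation rneg_def)

lemma mult_mono:
  "\<lbrakk>y \<sqsubseteq> z; x \<in> carrier A; y \<in> carrier A; z \<in> carrier A\<rbrakk> \<Longrightarrow> x \<cdot> y \<sqsubseteq> x \<cdot> z"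
  by (metis leq_refl leq_trans mult_closed resid_closed residuation)

text \<open>Multiplication by \<open>x\<close> on the left is lower adjoint to
  \<open>x \<setminus> _\<close>. This is the substitute for distributivity throughout.\<close>

lemma mult_join:
  assumes "x \<in> carrier A" "y \<in> carrier A" "z \<in> carrier A"
  shows "x \<cdot> (y \<squnion> z) = x \<cdot> y \<squnion> x \<cdot> z"
proof (rule leq_antisym)
  show "x \<cdot> (y \<squnion> z) \<sqsubseteq> x \<cdot> y \<squnion> x \<cdot> z"
    using assms by (simp add: residuation) (simp flip: residuation)
  show "x \<cdot> y \<squnion> x \<cdot> z \<sqsubseteq> x \<cdot> (y \<squnion> z)"
    using assms by (simp add: mult_mono)
qed (use assms in auto)

lemma mult_bot [simp]: "x \<in> carrier A \<Longrightarrow> x \<cdot> \<bottom> = \<bottom>"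
  by (metis bot_closed bot_least leq_rneg_iff rneg_closed)

text \<open>The product \<open>x \<cdot> \<bottom>\<close> unfolds to
  \<open>x \<sqinter> neg A x\<close>, so residuation forces \<open>neg\<close> to be a
  complement.\<close>

lemma meet_neg [simp]: "x \<in> carrier A \<Longrightarrow> x \<sqinter> neg A x = \<bottom>"
  by (metis bounds_simps(4) closed(3) mult_bot mult_def)

lemma join_neg [simp]: "x \<in> carrier A \<Longrightarrow> x \<squnion> neg A x = \<top>"
  by (metis meet_neg neg_bot neg_closed neg_meet neg_neg join_comm)

lemma mult_neg [simp]: "x \<in> carrier A \<Longrightarrow> x \<cdot> neg A x = \<bottom>"
  by (simp add: mult_absorb_neg)

lemma mult_top [simp]: "x \<in> carrier A \<Longrightarrow> x \<cdot> \<top> = x"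
  by (simp add: mult_def)

lemma mult_split:
  assumes "x \<in> carrier A" "y \<in> carrier A" "z \<in> carrier A" "y \<squnion> z = \<top>"
  shows "x = x \<cdot> y \<squnion> x \<cdot> z"
  using assms by (metis mult_join mult_top)

text \<open>For \<open>w \<sqsubseteq> x\<close> the element \<open>neg A w\<close> lies above
  \<open>neg A x\<close>, so its product with \<open>x\<close> is a meet. Preservation of joins then
  makes \<open>x \<sqinter> _\<close> distribute over \<open>neg A y \<squnion> neg A z\<close>, and
  negating gives the claim.\<close>

lemma neg_join_meet_distrib:
  assumes "x \<in> carrier A" "y \<in> carrier A" "z \<in> carrier A" "y \<sqsubseteq> x" "z \<sqsubseteq> x"
  shows "neg A x \<squnion> (y \<sqinter> z) = (neg A x \<squnion> y) \<sqinter> (neg A x \<squnion> z)"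
proof -
  have m: "x \<cdot> neg A w = x \<sqinter> neg A w" if "w \<in> carrier A" "w \<sqsubseteq> x" for w
    using that assms by (simp add: mult_absorb_neg neg_leq_iff)
  have "y \<sqinter> z \<sqsubseteq> x"
    using assms by (meson closed leq_trans meet_leq1)
  then have "x \<sqinter> (neg A y \<squnion> neg A z) = (x \<sqinter> neg A y) \<squnion> (x \<sqinter> neg A z)"
    using mult_join[of x "neg A y" "neg A z"] m[of y] m[of z] m[of "y \<sqinter> z"] assms
    by (simp add: neg_meet)
  then have "neg A (x \<sqinter> (neg A y \<squnion> neg A z)) = neg A ((x \<sqinter> neg A y) \<squnion> (x \<sqinter> neg A z))"
    by simp
  then show ?thesis
    using assms by (simp add: neg_meet neg_join neg_neg)
qed

text \<open>With \<open>p = b \<cdot> a\<close> and \<open>c = \<not>a \<or> p\<close>, distributivity below \<open>c\<close> gives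
  \<open>\<not>c = \<not>c \<or> (p \<and> \<not>a) = (\<not>c \<or> p) \<and> (\<not>c \<or> \<not>a) = \<not>c \<or> p\<close>, so that \<open>p\<close> lies below both
  \<open>c\<close> and \<open>\<not>c\<close>.\<close>

lemma mult_eq_bot_sym:
  assumes a: "a \<in> carrier A" and b: "b \<in> carrier A" and ab: "a \<cdot> b = \<bottom>"
  shows "b \<cdot> a = \<bottom>"
proof -
  define p where "p = b \<cdot> a"
  define c where "c = neg A a \<squnion> p"
  have [simp]: "p \<in> carrier A" "c \<in> carrier A" "a \<in> carrier A" "b \<in> carrier A"
    by (simp_all add: p_def c_def a b)
  \<comment> \<open>The left side unfolds to \<open>a \<sqinter> c\<close>; its vanishing makes the
    factor \<open>neg A c \<squnion> neg A a\<close> equal to \<open>\<top>\<close>.\<close>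
  have "a \<cdot> p \<sqsubseteq> a \<cdot> b"
    by (intro mult_mono) (simp_all add: p_def)
  then have "a \<sqinter> c = \<bottom>"
    by (simp add: ab leq_bot_iff) (simp add: mult_def c_def)
  then have "neg A a \<squnion> neg A c = \<top>"
    by (metis \<open>a \<in> carrier A\<close> \<open>c \<in> carrier A\<close> neg_meet neg_bot)
  \<comment> \<open>The aim is \<open>p \<sqinter> neg A a = \<bottom>\<close>: both
    \<open>p\<close> and \<open>neg A p\<close> turn out to lie below
    \<open>neg A p \<squnion> a\<close>.\<close>
  have "p \<sqsubseteq> neg A b \<squnion> a"
    by (simp add: p_def mult_def)
  also have "neg A b \<squnion> a \<sqsubseteq> neg A p \<squnion> a"
    using neg_antimono[of p b] by (simp add: p_def) (meson a b closed join_geq1 leq_trans mult_closed)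
  finally (leq_trans) have "p \<sqsubseteq> neg A p \<squnion> a"
    by simp
  then have "p \<squnion> neg A p \<sqsubseteq> neg A p \<squnion> a"
    by (simp del: join_neg)
  then have "neg A p \<squnion> a = \<top>"
    by (simp add: top_leq_iff)
  then have "p \<sqinter> neg A a = \<bottom>"
    by (metis \<open>a \<in> carrier A\<close> \<open>p \<in> carrier A\<close> closed(3) neg_join neg_neg neg_bot bot_closed)
  then have "neg A c = (neg A c \<squnion> p) \<sqinter> (neg A c \<squnion> neg A a)"
    using neg_join_meet_distrib[of c p "neg A a"] by (simp add: c_def)
  then have "p \<sqsubseteq> neg A c"
    using \<open>neg A a \<squnion> neg A c = \<top>\<close> 
    by (metis \<open>a \<in> carrier A\<close> \<open>c \<in> carrier A\<close> \<open>p \<in> carrier A\<close> bounds_simps(6) closed(2,3) join_comm join_geq2)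
  moreover have "p \<sqsubseteq> c"
    by (simp add: c_def)
  ultimately have "p \<sqsubseteq> c \<sqinter> neg A c"
    by (simp del: meet_neg)
  then show ?thesis
    by (simp add: leq_bot_iff p_def)
qed

section \<open>The Galois connection and the closure operator \<open>\<sim>\<sim>\<close>\<close>

lemma leq_rneg_swap:
  "\<lbrakk>x \<in> carrier A; y \<in> carrier A\<rbrakk> \<Longrightarrow> x \<sqsubseteq> \<sim> y \<longleftrightarrow> y \<sqsubseteq> \<sim> x"
  by (metis leq_rneg_iff mult_eq_bot_sym)

lemma leq_rneg_rneg [simp]: "x \<in> carrier A \<Longrightarrow> x \<sqsubseteq> \<sim> \<sim> x"
  by (simp add: leq_rneg_swap[of x])

lemma rneg_antimono:
  "\<lbrakk>x \<sqsubseteq> y; x \<in> carrier A; y \<in> carrier A\<rbrakk> \<Longrightarrow> \<sim> y \<sqsubseteq> \<sim> x"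
  by (meson leq_rneg_rneg leq_rneg_swap leq_trans rneg_closed)

lemma rneg_rneg_rneg [simp]: "x \<in> carrier A \<Longrightarrow> \<sim> \<sim> \<sim> x = \<sim> x"
  by (simp add: leq_antisym rneg_antimono)

lemma neg_leq_rneg [simp]: "x \<in> carrier A \<Longrightarrow> neg A x \<sqsubseteq> \<sim> x"
  by (simp add: leq_rneg_iff)

text \<open>The product \<open>x \<cdot> \<sim> x\<close> vanishes, and it is a meet because
  \<open>neg A x \<sqsubseteq> \<sim> x\<close>.\<close>

lemma meet_rneg [simp]:
  assumes "x \<in> carrier A"
  shows "x \<sqinter> \<sim> x = \<bottom>"
proof -
  have "x \<cdot> \<sim> x = \<bottom>"
    using assms by (simp flip: leq_rneg_iff)
  then show ?thesis
    using assms by (simp add: mult_absorb_neg)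
qed

lemma join_rneg [simp]:
  assumes "x \<in> carrier A"
  shows "x \<squnion> \<sim> x = \<top>"
proof -
  have "neg A x \<sqsubseteq> x \<squnion> \<sim> x"
    using leq_trans[of "neg A x" "\<sim> x" "x \<squnion> \<sim> x"] assms by simp
  then have "x \<squnion> neg A x \<sqsubseteq> x \<squnion> \<sim> x"
    using assms by (simp del: join_neg)
  then show ?thesis
    using assms by (simp add: top_leq_iff)
qed

lemma rneg_join:
  assumes "x \<in> carrier A" "y \<in> carrier A"
  shows "\<sim> (x \<squnion> y) = \<sim> x \<sqinter> \<sim> y"
proof (rule leq_antisym)
  show "\<sim> (x \<squnion> y) \<sqsubseteq> \<sim> x \<sqinter> \<sim> y"
    using assms by (simp add: rneg_antimono)
  show "\<sim> x \<sqinter> \<sim> y \<sqsubseteq> \<sim> (x \<squnion> y)"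
    using assms by (simp add: leq_rneg_swap[of "\<sim> x \<sqinter> \<sim> y"]
        leq_rneg_swap[of x "\<sim> x \<sqinter> \<sim> y"] leq_rneg_swap[of y "\<sim> x \<sqinter> \<sim> y"])
qed (use assms in auto)

lemma rneg_top [simp]: "\<sim> \<top> = \<bottom>"
  by (metis bounds_simps(5) meet_rneg rneg_closed top_closed)

lemma rneg_bot [simp]: "\<sim> \<bottom> = \<top>"
  by (metis bot_closed bounds_simps(3) join_rneg rneg_closed)

section \<open>Closed elements: products, joins, meets and residuals\<close>

text \<open>It suffices that \<open>t \<cdot> x\<close> annihilates \<open>c = \<sim> x\<close>.
  Both joinands of the factor \<open>f\<close> of \<open>t \<cdot> x\<close> lie below
  \<open>\<sim> (c \<sqinter> t)\<close>, so \<open>f\<close> is disjoint from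
  \<open>c \<sqinter> t\<close>, and hence \<open>t \<cdot> x\<close> from \<open>c\<close>.\<close>

lemma mult_leq_rneg_rneg:
  assumes x: "x \<in> carrier A" and t: "t \<in> carrier A" and xt: "x \<sqsubseteq> t"
  shows "t \<cdot> x \<sqsubseteq> \<sim> \<sim> x"
proof -
  define c where "c = \<sim> x"
  define f where "f = neg A t \<squnion> x"
  have [simp]: "x \<in> carrier A" "t \<in> carrier A" "c \<in> carrier A" "f \<in> carrier A"
    by (simp_all add: c_def f_def x t)
  have "neg A t \<sqsubseteq> neg A x"
    using xt by (simp add: neg_antimono)
  then have tc: "neg A t \<sqsubseteq> c"
    unfolding c_def by (meson neg_leq_rneg leq_trans neg_closed rneg_closed x t)
  have tct: "neg A t \<sqsubseteq> \<sim> (c \<sqinter> t)"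
    by (meson \<open>c \<in> carrier A\<close> meet_leq2 neg_leq_rneg leq_trans neg_closed rneg_closed rneg_antimono
      meet_closed t)
  have xct: "x \<sqsubseteq> \<sim> (c \<sqinter> t)"
    by (simp add: leq_rneg_swap[of x]) (simp add: c_def)
  from tct xct have "f \<sqsubseteq> \<sim> (c \<sqinter> t)"
    by (simp add: f_def)
  then have *: "f \<cdot> (c \<sqinter> t) = \<bottom>"
    by (simp add: leq_rneg_iff mult_eq_bot_sym)
  have "f \<sqinter> (c \<sqinter> t) = \<bottom>"
    using meet_leq_mult[of f "c \<sqinter> t"] * by (simp add: leq_bot_iff)
  moreover have "t \<cdot> x = f \<sqinter> t"
    by (simp add: mult_def f_def meet_comm)
  ultimately have m: "(t \<cdot> x) \<sqinter> c = \<bottom>"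
    by (metis \<open>c \<in> carrier A\<close> \<open>f \<in> carrier A\<close> meet_assoc meet_comm meet_closed t)
  \<comment> \<open>This puts \<open>neg A (t \<cdot> x)\<close> below \<open>neg A x\<close> and so
    below \<open>c\<close>, which turns the vanishing meet into a vanishing product.\<close>
  have "x \<sqsubseteq> t \<cdot> x"
    using xt by (simp add: mult_def)
  then have "neg A (t \<cdot> x) \<sqsubseteq> c"
    unfolding c_def by (meson neg_antimono neg_leq_rneg leq_trans neg_closed rneg_closed x t mult_closed)
  with m have "(t \<cdot> x) \<cdot> c = \<bottom>"
    by (simp add: mult_absorb_neg)
  then have "c \<sqsubseteq> \<sim> (t \<cdot> x)"
    by (simp add: leq_rneg_iff)
  then show ?thesis
    by (simp add: c_def leq_rneg_swap[of _ "\<sim> x"])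
qed

text \<open>For closed \<open>x\<close> the preceding upper bound is \<open>x\<close> itself. The
  identity is the dual form of the orthomodular law, still written with \<open>neg\<close>.\<close>

lemma mult_regular:
  assumes "x \<in> carrier A" "t \<in> carrier A" "x \<sqsubseteq> t" "\<sim> \<sim> x = x"
  shows "t \<cdot> x = x"
proof (rule leq_antisym)
  show "t \<cdot> x \<sqsubseteq> x"
    using mult_leq_rneg_rneg assms by metis
  show "x \<sqsubseteq> t \<cdot> x"
    using assms by (simp add: mult_def)
qed (use assms in auto)

text \<open>The closure \<open>?t\<close> of \<open>b = x \<squnion> y\<close> splits along
  \<open>b\<close> and \<open>neg A b\<close>. The second product vanishes, and the first
  distributes over \<open>x\<close> and \<open>y\<close>, which \<open>?t\<close> fixes.\<close>

lemma rneg_rneg_join: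
  assumes x: "x \<in> carrier A" "\<sim> \<sim> x = x" and y: "y \<in> carrier A" "\<sim> \<sim> y = y"
  shows "\<sim> \<sim> (x \<squnion> y) = x \<squnion> y"
proof -
  define b where "b = x \<squnion> y"
  have b [simp]: "b \<in> carrier A" and [simp]: "x \<in> carrier A" "y \<in> carrier A"
    using x y by (simp_all add: b_def)
  let ?t = "\<sim> \<sim> b"
  \<comment> \<open>Here \<open>\<sim> ?t\<close> is \<open>\<sim> b\<close>, since a triple
    \<open>\<sim>\<close> collapses.\<close>
  have "neg A b \<sqsubseteq> \<sim> ?t"
    by simp
  then have "?t \<cdot> neg A b = \<bottom>"
    by (simp only: leq_rneg_iff rneg_closed closed b)
  then have "?t = ?t \<cdot> b"
    using mult_split[of ?t b "neg A b"] by simp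
  also have "\<dots> = ?t \<cdot> x \<squnion> ?t \<cdot> y"
    by (simp add: b_def mult_join)
  also have "\<dots> = b"
  proof -
    have "x \<sqsubseteq> ?t" "y \<sqsubseteq> ?t"
      using leq_trans[of x b ?t] leq_trans[of y b ?t] by (simp_all add: b_def)
    with x y show ?thesis
      by (simp add: mult_regular b_def)
  qed
  finally show ?thesis
    by (simp add: b_def)
qed

text \<open>The meet is \<open>\<sim> (\<sim> x \<squnion> \<sim> y)\<close>, and every value of
  \<open>\<sim>\<close> is closed.\<close>

lemma rneg_rneg_meet:
  assumes "x \<in> carrier A" "\<sim> \<sim> x = x" "y \<in> carrier A" "\<sim> \<sim> y = y"
  shows "\<sim> \<sim> (x \<sqinter> y) = x \<sqinter> y"
  using assms by (metis closed(2) rneg_closed rneg_join rneg_rneg_rneg)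

text \<open>Split \<open>y\<close> along \<open>x \<squnion> \<sim> x = \<top>\<close>: the product
  \<open>y \<cdot> x\<close> is \<open>x\<close>, and \<open>y \<cdot> \<sim> x\<close> is a meet
  because \<open>neg A y \<sqsubseteq> \<sim> x\<close>.\<close>

lemma regular_orthomodular:
  assumes x: "x \<in> carrier A" "\<sim> \<sim> x = x" and y: "y \<in> carrier A" and xy: "x \<sqsubseteq> y"
  shows "y = x \<squnion> (y \<sqinter> \<sim> x)"
proof -
  have "neg A y \<sqsubseteq> \<sim> x"
    by (meson neg_leq_rneg leq_trans rneg_antimono neg_closed rneg_closed assms)
  then show ?thesis
    using mult_split[of y x "\<sim> x"] assms by (simp add: mult_regular mult_absorb_neg)
qed

lemma regular_resid:
  assumes x: "x \<in> carrier A" "\<sim> \<sim> x = x" and y: "y \<in> carrier A" "\<sim> \<sim> y = y"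
  shows "x \<setminus> y = \<sim> x \<squnion> (x \<sqinter> y)"
proof (rule leq_antisym)
  define q where "q = x \<setminus> y"
  have [simp]: "x \<in> carrier A" "y \<in> carrier A" "q \<in> carrier A"
    using x y by (simp_all add: q_def)
  have xn: "x \<cdot> \<sim> x = \<bottom>"
    by (simp flip: leq_rneg_iff)
  have nq: "\<sim> x \<sqsubseteq> q"
    by (simp add: q_def xn bot_least flip: residuation)
  then have "neg A q \<sqsubseteq> x"
    by (meson neg_leq_rneg neg_leq_swap leq_trans neg_closed rneg_closed \<open>x \<in> carrier A\<close> \<open>q \<in> carrier A\<close>)
  \<comment> \<open>Of the two parts of \<open>q\<close>, \<open>q \<cdot> x\<close> is a meet as
    \<open>neg A q \<sqsubseteq> x\<close>, and \<open>q \<cdot> \<sim> x\<close> is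
    \<open>\<sim> x\<close>, which is closed and below \<open>q\<close>.\<close>
  then have "q = (q \<sqinter> x) \<squnion> \<sim> x"
    using mult_split[of q x "\<sim> x"] nq by (simp add: mult_regular mult_absorb_neg)
  moreover have "q \<sqinter> x \<sqsubseteq> \<sim> x \<squnion> (x \<sqinter> y)"
  proof -
    have "x \<cdot> q \<sqsubseteq> y"
      by (simp add: residuation q_def)
    moreover have "q \<sqinter> x \<sqsubseteq> x \<cdot> q"
      using meet_leq_mult[of x q] by (simp add: meet_comm)
    ultimately have "q \<sqinter> x \<sqsubseteq> y"
      by (meson leq_trans meet_closed mult_closed \<open>x \<in> carrier A\<close> \<open>y \<in> carrier A\<close> \<open>q \<in> carrier A\<close>)
    then show ?thesis
      using leq_trans[of "q \<sqinter> x" "x \<sqinter> y" "\<sim> x \<squnion> (x \<sqinter> y)"] by simp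
  qed
  ultimately have "q \<sqsubseteq> \<sim> x \<squnion> (x \<sqinter> y)"
    by (metis \<open>x \<in> carrier A\<close> \<open>y \<in> carrier A\<close> \<open>q \<in> carrier A\<close> closed(1,2) rneg_closed
      join_geq1 join_leq_iff)
  then show "x \<setminus> y \<sqsubseteq> \<sim> x \<squnion> (x \<sqinter> y)"
    by (simp add: q_def)
  \<comment> \<open>Conversely, multiplication by \<open>x\<close> kills \<open>\<sim> x\<close> and
    fixes the closed element \<open>x \<sqinter> y\<close>, so residuation applies.\<close>
  have "x \<cdot> (x \<sqinter> y) = x \<sqinter> y"
    using assms by (simp add: mult_regular rneg_rneg_meet)
  then have "x \<cdot> (\<sim> x \<squnion> (x \<sqinter> y)) = x \<sqinter> y"
    by (simp add: mult_join xn)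
  then show "\<sim> x \<squnion> (x \<sqinter> y) \<sqsubseteq> x \<setminus> y"
    by (simp flip: residuation del: join_leq_iff)
qed (use x y in auto)

end

section \<open>The orthomodular lattice of closed elements\<close>

definition regular_algebra :: "('a, 'm) rol_alg_scheme \<Rightarrow> ('a, 'm) rol_alg_scheme"
  where "regular_algebra A = A\<lparr>carrier := rneg A ` carrier A, neg := rneg A\<rparr>"

lemma regular_algebra_simps [simp]:
  "x \<sqinter>\<^bsub>regular_algebra A\<^esub> y = x \<sqinter>\<^bsub>A\<^esub> y"
  "x \<squnion>\<^bsub>regular_algebra A\<^esub> y = x \<squnion>\<^bsub>A\<^esub> y"
  "x \<setminus>\<^bsub>regular_algebra A\<^esub> y = x \<setminus>\<^bsub>A\<^esub> y"
  "neg (regular_algebra A) x = \<sim>\<^bsub>A\<^esub> x"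
  "\<bottom>\<^bsub>regular_algebra A\<^esub> = \<bottom>\<^bsub>A\<^esub>"
  "\<top>\<^bsub>regular_algebra A\<^esub> = \<top>\<^bsub>A\<^esub>"
  "x \<sqsubseteq>\<^bsub>regular_algebra A\<^esub> y \<longleftrightarrow> x \<sqsubseteq>\<^bsub>A\<^esub> y"
  by (simp_all add: regular_algebra_def leq_def)

text \<open>The image of \<open>\<sim>\<close> is the set of fixed points of
  \<open>\<sim>\<sim>\<close>, because a triple \<open>\<sim>\<close> collapses.\<close>

lemma (in residuated_ortholattice) carrier_regular_algebra:
  "x \<in> carrier (regular_algebra A) \<longleftrightarrow> x \<in> carrier A \<and> \<sim> \<sim> x = x"
  by (auto simp: regular_algebra_def image_iff) (metis rneg_closed)

lemma orthomodular_regular_algebra: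
  assumes "residuated_ortholattice A"
  shows "orthomodular_lattice (regular_algebra A)"
proof -
  interpret residuated_ortholattice A by fact
  show ?thesis
    by unfold_locales
      (auto simp: carrier_regular_algebra rneg_rneg_meet rneg_rneg_join regular_resid
        meet_assoc join_assoc meet_absorb join_absorb bot_least top_greatest rneg_antimono
        intro: meet_comm join_comm regular_orthomodular)
qed

section \<open>Evaluation of translated terms and transfer of consequences\<close>

lemma eval_regular_algebra:
  "eval (regular_algebra A) (\<lambda>i. \<sim>\<^bsub>A\<^esub> \<sim>\<^bsub>A\<^esub> h i) s = eval A h (T s)"
  by (induction s) (simp_all add: rneg_def)

text \<open>The Sasaki hook gives \<open>x \<setminus> \<bottom> = neg A x\<close>. Membership in
  the carrier is proved in the same induction because the laws hold only there.\<close>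

lemma (in orthomodular_lattice) eval_T:
  assumes "h \<in> UNIV \<rightarrow> carrier A"
  shows "eval A h s \<in> carrier A \<and> eval A h (T s) = eval A h s"
proof (induction s)
  case (Var i)
  then show ?case
    using assms by (auto simp: resid_Sasaki neg_neg Pi_iff)
next
  case (Neg s)
  then show ?case
    by (simp add: resid_Sasaki)
qed simp_all

theorem theorem4p11:
  fixes E :: "equation set" and U V W :: "'a rol_alg set"
  assumes "V = OML \<oplus> E"
    and "W = ROL \<oplus> T[E]"
    and "rol_variety U"
    and "V \<subseteq> U" and "U \<subseteq> W"
  shows "translatable V U"
proof -
  \<comment> \<open>Since \<open>U \<subseteq> W\<close>, \<open>A\<close> satisfies
    \<open>T[E]\<close>, which amounts to \<open>E\<close> holding for closed elements.\<close>
  have regular: "regular_algebra A \<in> V" if "A \<in> U" for A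
  proof -
    have "A \<in> ROL \<oplus> T[E]"
      using that assms by blast
    then interpret residuated_ortholattice A
      by (simp add: axiomatized_by_def ROL_def)
    have "valid (regular_algebra A) (u, v)" if "(u, v) \<in> E" for u v
      unfolding valid_def satisfies_def
    proof
      fix h :: "nat \<Rightarrow> 'a"
      assume h: "h \<in> UNIV \<rightarrow> carrier (regular_algebra A)"
      \<comment> \<open>An assignment of closed elements is its own double \<open>\<sim>\<close>, so
        evaluation of a term under it is evaluation of the translation in \<open>A\<close>.\<close>
      then have "(\<lambda>i. \<sim>\<^bsub>A\<^esub> \<sim>\<^bsub>A\<^esub> h i) = h" and "h \<in> UNIV \<rightarrow> carrier A"
        by (auto simp: carrier_regular_algebra Pi_iff)
      moreover have "valid A (T u, T v)"
        using \<open>A \<in> ROL \<oplus> T[E]\<close> that by (auto simp: axiomatized_by_def T_eqs_def)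
      ultimately show "eval (regular_algebra A) h (fst (u, v)) = eval (regular_algebra A) h (snd (u, v))"
        using eval_regular_algebra[of A h] by (simp add: valid_def satisfies_def)
    qed
    then show ?thesis
      using orthomodular_regular_algebra[of A] residuated_ortholattice_axioms
      by (auto simp: assms(1) axiomatized_by_def OML_def)
  qed
  have "T[D] \<Turnstile>\<^bsub>U\<^esub> (T s, T t)" if D: "D \<Turnstile>\<^bsub>V\<^esub> (s, t)" for D s t
    unfolding consequence_def
  proof (intro ballI impI)
    fix A h
    assume A: "A \<in> U" and h: "h \<in> UNIV \<rightarrow> carrier A" and sat: "\<forall>d \<in> T[D]. satisfies A h d"
    interpret residuated_ortholattice A
      using A assms(2,5) by (auto simp: axiomatized_by_def ROL_def)
    \<comment> \<open>Closing the values of \<open>h\<close> gives an assignment in a member of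
      \<open>V\<close> under which terms take the values of their translations under
      \<open>h\<close>.\<close>
    let ?g = "\<lambda>i. \<sim>\<^bsub>A\<^esub> \<sim>\<^bsub>A\<^esub> h i"
    have "?g \<in> UNIV \<rightarrow> carrier (regular_algebra A)"
      using h by (auto simp: carrier_regular_algebra Pi_iff)
    moreover have "\<forall>d \<in> D. satisfies (regular_algebra A) ?g d"
      using sat by (force simp: satisfies_def eval_regular_algebra T_eqs_def)
    ultimately show "satisfies A h (T s, T t)"
      using D regular[OF A] by (fastforce simp: consequence_def satisfies_def eval_regular_algebra)
  qed
  moreover have "D \<Turnstile>\<^bsub>V\<^esub> (s, t)" if D: "T[D] \<Turnstile>\<^bsub>U\<^esub> (T s, T t)" for D s t
    unfolding consequence_def
  proof (intro ballI impI)
    fix A h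
    assume A: "A \<in> V" and h: "h \<in> UNIV \<rightarrow> carrier A" and sat: "\<forall>d \<in> D. satisfies A h d"
    interpret orthomodular_lattice A
      using A assms(1) by (auto simp: axiomatized_by_def OML_def)
    \<comment> \<open>Values in \<open>A\<close> are unchanged by \<open>T\<close>, so
      \<open>A\<close> itself, as a member of \<open>U\<close>, and the same \<open>h\<close> serve
      for the other direction.\<close>
    have "\<forall>d \<in> T[D]. satisfies A h d"
      using sat by (force simp: satisfies_def eval_T[OF h] T_eqs_def)
    moreover have "A \<in> U"
      using A assms(4) by blast
    ultimately have "satisfies A h (T s, T t)"
      using D h by (auto simp: consequence_def)
    then show "satisfies A h (s, t)"
      by (simp add: satisfies_def eval_T[OF h])
  qed
  ultimately show ?thesis
    unfolding translatable_def by blast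
qed

end
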